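(* Let $R,R'$ be projective surfaces with smooth conformal metrics $\rho,\sigma$, respectively, and let $f:R\to R'$ be a nonconstant holomorphic map. Then $$\Sigma_{\sigma,\rho} f=\rho^{-2}\left[S_{R,R'}f+f^*\Theta_{R',\sigma}-\Theta_{R,\rho}\right],$$ where $f^*\Theta_{R',\sigma}$ is the pull-back $(\Theta_{R',\sigma}\circ f)(f')^2$ as a quadratic differential.
   Context: A projective surface is a surface with an equivalence class of atlases of complex charts whose transition maps are (restrictions of) Möbius transformations on each connected component; the charts of such atlases are called projective coordinates. A projective surface is regarded as a Riemann surface via its underlying complex structure. A conformal metric $\rho=\rho(z)|dz|$ is given in local coordinates by a smooth positive function, with $\rho(z)|dz|$ invariant under change of coordinates. Write $\partial=\partial/\partial z=\frac12(\partial_x-i\partial_y)$. Schwarzian of a map: for $f:R\to R'$ nonconstant holomorphic, $S_{R,R'}f$ is the meromorphic quadratic differential on $R$ given in projective coordinates $z$ of $R$ and $w$ of $R'$ by $S(w\circ f\circ z^{-1})\,dz^2$, where $Sg=\left(\frac{g''}{g'}\right)'-\frac12\left(\frac{g''}{g'}\right)^2$; it does not depend on the choice of projective coordinates. Schwarzian of a metric: $\Theta_{R,\rho}$ is the smooth quadratic differential on $R$ given in projective coordinates $z$ by $\Theta_{R,\rho}(z)\,dz^2$, $\Theta_{R,\rho}(z)=2\partial^2\log\rho(z)-2(\partial\log\rho(z))^2$; similarly $\Theta_{R',\sigma}$. Invariant Schwarzian: in local coordinates $z$ on $R$ and $w$ on $R'$ (identify $f$ with $w\circ f\circ z^{-1}$),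 set $\partial_\rho\varphi=\frac1{\rho}\frac{\partial\varphi}{\partial z}$, $\partial_\sigma\varphi=\frac1\sigma\frac{\partial\varphi}{\partial w}$, and define the Peschl–Minda derivatives by $$D^1f=\frac{\sigma\circ f}{\rho}f',\qquad D^{n+1}f=\left[\partial_\rho-n\,\partial_\rho(\log\rho)+(\partial_\sigma\log\sigma)\circ f\cdot D^1f\right]D^nf\quad(n\ge1).$$ Put $Q^nf=D^{n+1}f/D^1f$ and $$\Sigma_{\sigma,\rho}f=Q^2f-\tfrac32(Q^1f)^2$$ (defined where $f'\neq0$). This does not depend on the coordinate $w$, and under a holomorphic change of coordinate $z=g(\hat z)$ it is composed with $g$ and multiplied by $(g'/|g'|)^2$. The asserted identity is between the expressions evaluated in one and the same projective coordinate $z$ of $R$, at points where $f'\ne0$. *)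

theory Defs
  imports "HOL-Analysis.Analysis"
begin

section \<open>Charts and projective surfaces\<close>

text \<open>A chart is a domain together with a coordinate map. The values of the map outside the domain
  are irrelevant.\<close>

type_synonym 'a chart = "'a set \<times> ('a \<Rightarrow> complex)"

definition complex_chart :: "'a topology \<Rightarrow> 'a chart \<Rightarrow> bool" where
  "complex_chart X z \<longleftrightarrow> openin X (fst z) \<and> open (snd z ` fst z) \<and>
     homeomorphic_map (subtopology X (fst z)) (top_of_set (snd z ` fst z)) (snd z)"

abbreviation chart_inv :: "'a chart \<Rightarrow> complex \<Rightarrow> 'a" where
  "chart_inv z \<equiv> inv_into (fst z) (snd z)"

definition in_coords :: "'a chart \<Rightarrow> 'b chart \<Rightarrow> ('a \<Rightarrow> 'b) \<Rightarrow> complex \<Rightarrow> complex" where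
  "in_coords z w f = snd w \<circ> f \<circ> chart_inv z"

abbreviation transition :: "'a chart \<Rightarrow> 'a chart \<Rightarrow> complex \<Rightarrow> complex" where
  "transition z w \<equiv> in_coords z w id"

text \<open>The condition \<open>c * x + d \<noteq> 0\<close> says that the value of the Moebius transformation
  at \<open>x\<close> is not the point at infinity.\<close>

definition moebius_on :: "complex set \<Rightarrow> (complex \<Rightarrow> complex) \<Rightarrow> bool" where
  "moebius_on C T \<longleftrightarrow> (\<exists>a b c d. a * d - b * c \<noteq> 0 \<and>
     (\<forall>x\<in>C. c * x + d \<noteq> 0 \<and> T x = (a * x + b) / (c * x + d)))"

definition projective_atlas :: "'a topology \<Rightarrow> 'a chart set \<Rightarrow> bool" where
  "projective_atlas X \<A> \<longleftrightarrow>
     (\<forall>z\<in>\<A>. complex_chart X z) \<and> (\<Union>z\<in>\<A>. fst z) = topspace X \<and>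
     (\<forall>z\<in>\<A>. \<forall>w\<in>\<A>. \<forall>C\<in>components (snd z ` (fst z \<inter> fst w)). moebius_on C (transition z w))"

definition projective_equiv :: "'a topology \<Rightarrow> ('a chart set \<times> 'a chart set) set" where
  "projective_equiv X =
     {(\<A>, \<B>). projective_atlas X \<A> \<and> projective_atlas X \<B> \<and> projective_atlas X (\<A> \<union> \<B>)}"

text \<open>A projective structure \<open>\<P>\<close> is an equivalence class of atlases. Surfaces are connected,
  as usual for Riemann surfaces; second countability is automatic by Rado's theorem.\<close>

definition projective_surface :: "'a topology \<Rightarrow> 'a chart set set \<Rightarrow> bool" where
  "projective_surface X \<P> \<longleftrightarrow> Hausdorff_space X \<and> connected_space X \<and>
     \<P> \<in> {\<A>. projective_atlas X \<A>} // projective_equiv X"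

definition projective_coord :: "'a chart set set \<Rightarrow> 'a chart \<Rightarrow> bool" where
  "projective_coord \<P> z \<longleftrightarrow> z \<in> \<Union>\<P>"

text \<open>The local coordinates of the underlying Riemann surface, i.e. the maximal holomorphic atlas
  determined by the projective coordinates.\<close>

definition local_coord :: "'a topology \<Rightarrow> 'a chart set set \<Rightarrow> 'a chart \<Rightarrow> bool" where
  "local_coord X \<P> z \<longleftrightarrow> complex_chart X z \<and>
     (\<forall>w. projective_coord \<P> w \<longrightarrow>
        transition z w holomorphic_on snd z ` (fst z \<inter> fst w) \<and>
        transition w z holomorphic_on snd w ` (fst z \<inter> fst w))"

definition holomorphic_surface_map ::
  "'a topology \<Rightarrow> 'a chart set set \<Rightarrow> 'b topology \<Rightarrow> 'b chart set set \<Rightarrow> ('a \<Rightarrow> 'b) \<Rightarrow> bool" where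
  "holomorphic_surface_map X \<P> Y \<Q> f \<longleftrightarrow> continuous_map X Y f \<and>
     (\<forall>z w. local_coord X \<P> z \<longrightarrow> local_coord Y \<Q> w \<longrightarrow>
        in_coords z w f holomorphic_on snd z ` {p \<in> fst z. f p \<in> fst w})"

section \<open>Conformal metrics\<close>

text \<open>\<open>Ck_on n f S\<close>: \<open>f\<close> is of class $C^n$ in the real sense on the open set \<open>S\<close>.\<close>

fun Ck_on :: "nat \<Rightarrow> ('a::real_normed_vector \<Rightarrow> 'b::real_normed_vector) \<Rightarrow> 'a set \<Rightarrow> bool" where
  "Ck_on 0 f S \<longleftrightarrow> continuous_on S f"
| "Ck_on (Suc n) f S \<longleftrightarrow> (\<forall>x\<in>S. f differentiable (at x)) \<and>
     (\<forall>v. Ck_on n (\<lambda>x. frechet_derivative f (at x) v) S)"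

definition smooth_on :: "('a::real_normed_vector \<Rightarrow> 'b::real_normed_vector) \<Rightarrow> 'a set \<Rightarrow> bool" where
  "smooth_on f S \<longleftrightarrow> (\<forall>n. Ck_on n f S)"

text \<open>\<open>\<rho> z\<close> is the density of the metric in the local coordinate \<open>z\<close>, a function of the
  coordinate value. The last clause is the invariance of \<open>\<rho>(z) |dz|\<close>.\<close>

definition conformal_metric ::
  "'a topology \<Rightarrow> 'a chart set set \<Rightarrow> ('a chart \<Rightarrow> complex \<Rightarrow> real) \<Rightarrow> bool" where
  "conformal_metric X \<P> \<rho> \<longleftrightarrow>
     (\<forall>z. local_coord X \<P> z \<longrightarrow>
        smooth_on (\<rho> z) (snd z ` fst z) \<and> (\<forall>\<zeta>\<in>snd z ` fst z. \<rho> z \<zeta> > 0)) \<and>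
     (\<forall>z w. local_coord X \<P> z \<longrightarrow> local_coord X \<P> w \<longrightarrow>
        (\<forall>p\<in>fst z \<inter> fst w.
           \<rho> z (snd z p) = \<rho> w (snd w p) * cmod (deriv (transition z w) (snd z p))))"

section \<open>Schwarzian derivatives of maps and metrics\<close>

definition wirtinger :: "(complex \<Rightarrow> complex) \<Rightarrow> complex \<Rightarrow> complex" ("\<partial>") where
  "\<partial> \<phi> z = (frechet_derivative \<phi> (at z) 1 - \<i> * frechet_derivative \<phi> (at z) \<i>) / 2"

definition clog_metric :: "(complex \<Rightarrow> real) \<Rightarrow> complex \<Rightarrow> complex" where
  "clog_metric \<rho> = (\<lambda>z. complex_of_real (ln (\<rho> z)))"

definition schwarzian :: "(complex \<Rightarrow> complex) \<Rightarrow> complex \<Rightarrow> complex" where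
  "schwarzian g z = deriv (\<lambda>t. deriv (deriv g) t / deriv g t) z
     - 1/2 * (deriv (deriv g) z / deriv g z)\<^sup>2"

text \<open>The following expressions are coefficients of quadratic differentials in terms of a
  projective coordinate \<open>z\<close> of the source, evaluated at the coordinate value \<open>\<zeta>\<close>; \<open>w\<close> is a
  projective coordinate of the target, on the choice of which they do not depend.\<close>

definition schwarzian_map ::
  "('a \<Rightarrow> 'b) \<Rightarrow> 'a chart \<Rightarrow> 'b chart \<Rightarrow> complex \<Rightarrow> complex" where
  "schwarzian_map f z w \<zeta> = schwarzian (in_coords z w f) \<zeta>"

definition schwarzian_metric ::
  "('a chart \<Rightarrow> complex \<Rightarrow> real) \<Rightarrow> 'a chart \<Rightarrow> complex \<Rightarrow> complex" where
  "schwarzian_metric \<rho> z \<zeta> =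
     2 * \<partial> (\<partial> (clog_metric (\<rho> z))) \<zeta> - 2 * (\<partial> (clog_metric (\<rho> z)) \<zeta>)\<^sup>2"

definition pullback_qd ::
  "('a \<Rightarrow> 'b) \<Rightarrow> ('b chart \<Rightarrow> complex \<Rightarrow> complex) \<Rightarrow> 'a chart \<Rightarrow> 'b chart \<Rightarrow> complex \<Rightarrow> complex" where
  "pullback_qd f \<Theta> z w \<zeta> = \<Theta> w (in_coords z w f \<zeta>) * (deriv (in_coords z w f) \<zeta>)\<^sup>2"

section \<open>The invariant Schwarzian\<close>

definition metric_partial :: "(complex \<Rightarrow> real) \<Rightarrow> (complex \<Rightarrow> complex) \<Rightarrow> complex \<Rightarrow> complex" where
  "metric_partial \<rho> \<phi> z = \<partial> \<phi> z / of_real (\<rho> z)"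

text \<open>Peschl--Minda derivatives of a holomorphic function between plane domains carrying the
  densities \<open>\<rho>\<close> (source) and \<open>\<sigma>\<close> (target). The order starts at 1; order 0 is left unspecified.\<close>

fun peschl_minda ::
  "(complex \<Rightarrow> real) \<Rightarrow> (complex \<Rightarrow> real) \<Rightarrow> (complex \<Rightarrow> complex) \<Rightarrow> nat \<Rightarrow> complex \<Rightarrow> complex" where
  "peschl_minda \<rho> \<sigma> f (Suc 0) =
     (\<lambda>z. of_real (\<sigma> (f z)) / of_real (\<rho> z) * deriv f z)"
| "peschl_minda \<rho> \<sigma> f (Suc (Suc n)) =
     (\<lambda>z. metric_partial \<rho> (peschl_minda \<rho> \<sigma> f (Suc n)) z
        + (- of_nat (Suc n) * metric_partial \<rho> (clog_metric \<rho>) z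
           + metric_partial \<sigma> (clog_metric \<sigma>) (f z) * peschl_minda \<rho> \<sigma> f (Suc 0) z)
          * peschl_minda \<rho> \<sigma> f (Suc n) z)"

definition peschl_minda_quot ::
  "(complex \<Rightarrow> real) \<Rightarrow> (complex \<Rightarrow> real) \<Rightarrow> (complex \<Rightarrow> complex) \<Rightarrow> nat \<Rightarrow> complex \<Rightarrow> complex" where
  "peschl_minda_quot \<rho> \<sigma> f n z = peschl_minda \<rho> \<sigma> f (n + 1) z / peschl_minda \<rho> \<sigma> f 1 z"

definition invariant_schwarzian ::
  "('a chart \<Rightarrow> complex \<Rightarrow> real) \<Rightarrow> ('b chart \<Rightarrow> complex \<Rightarrow> real) \<Rightarrow> ('a \<Rightarrow> 'b) \<Rightarrow>
   'a chart \<Rightarrow> 'b chart \<Rightarrow> complex \<Rightarrow> complex" where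
  "invariant_schwarzian \<rho> \<sigma> f z w \<zeta> =
     peschl_minda_quot (\<rho> z) (\<sigma> w) (in_coords z w f) 2 \<zeta>
     - 3/2 * (peschl_minda_quot (\<rho> z) (\<sigma> w) (in_coords z w f) 1 \<zeta>)\<^sup>2"

end

theory Submission
  imports Defs "HOL-Complex_Analysis.Cauchy_Integral_Formula"
begin

text \<open>Put \<open>T = f''/f' + 2 (\<partial> log \<sigma> \<circ> f) f'\<close>. A direct computation gives
  \<open>Q\<^sup>1 f = (T - 2 \<partial> log \<rho>) / \<rho>\<close>, and hence that the invariant Schwarzian is
  \<open>\<rho>\<^sup>-\<^sup>2 (\<partial> T - T\<^sup>2 / 2 - \<Theta>\<^sub>\<rho>)\<close>, while \<open>\<partial> T - T\<^sup>2 / 2 = S f + (\<Theta>\<^sub>\<sigma> \<circ> f) f'\<^sup>2\<close>. The function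
  \<open>T\<close> is unchanged under holomorphic changes of the coordinate \<open>w\<close>, because
  \<open>\<partial> log |g'| = g''/(2 g')\<close>, so one may pass from \<open>w\<close> to a projective coordinate; there the two
  summands are separately invariant, as the Schwarzian does not see Moebius transformations.\<close>

section \<open>Wirtinger calculus\<close>

text \<open>\<open>\<partial>\<close> is total, and at points without a real derivative its value is
  arbitrary. Bundling differentiability with the value gives rules that can be chained like those
  for \<open>has_field_derivative\<close>.\<close>

definition has_wirtinger :: "(complex \<Rightarrow> complex) \<Rightarrow> complex \<Rightarrow> complex \<Rightarrow> bool" where
  "has_wirtinger \<phi> a x \<longleftrightarrow> \<phi> differentiable (at x) \<and> \<partial> \<phi> x = a"

lemma has_wirtinger_imp_wirtinger: "has_wirtinger \<phi> a x \<Longrightarrow> \<partial> \<phi> x = a"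
  by (simp add: has_wirtinger_def)

lemma has_wirtinger_wirtinger: "\<phi> differentiable (at x) \<Longrightarrow> has_wirtinger \<phi> (\<partial> \<phi> x) x"
  by (simp add: has_wirtinger_def)

lemma has_wirtingerI:
  assumes "(\<phi> has_derivative D) (at x)" and "a = (D 1 - \<i> * D \<i>) / 2"
  shows "has_wirtinger \<phi> a x"
proof -
  have "frechet_derivative \<phi> (at x) = D"
    using frechet_derivative_at[OF assms(1)] by simp
  then show ?thesis
    using assms by (auto simp: has_wirtinger_def wirtinger_def differentiable_def)
qed

lemma has_wirtingerE:
  assumes "has_wirtinger \<phi> a x"
  obtains D where "(\<phi> has_derivative D) (at x)" and "a = (D 1 - \<i> * D \<i>) / 2"
  using assms by (auto simp: has_wirtinger_def wirtinger_def frechet_derivative_works)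

lemma has_wirtinger_eq_rhs: "has_wirtinger \<phi> a x \<Longrightarrow> a = b \<Longrightarrow> has_wirtinger \<phi> b x"
  by simp

lemma has_wirtinger_transform:
  assumes "has_wirtinger \<phi> a x" and "open S" and "x \<in> S" and "\<And>y. y \<in> S \<Longrightarrow> \<phi> y = \<psi> y"
  shows "has_wirtinger \<psi> a x"
proof -
  obtain D where D: "(\<phi> has_derivative D) (at x)" "a = (D 1 - \<i> * D \<i>) / 2"
    using assms(1) by (rule has_wirtingerE)
  then show ?thesis
    using has_derivative_transform_within_open[OF D(1) assms(2-4)] by (intro has_wirtingerI)
qed

lemma has_wirtinger_add:
  assumes "has_wirtinger \<phi> a x" and "has_wirtinger \<psi> b x"
  shows "has_wirtinger (\<lambda>y. \<phi> y + \<psi> y) (a + b) x"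
proof -
  obtain D where D: "(\<phi> has_derivative D) (at x)" "a = (D 1 - \<i> * D \<i>) / 2"
    using assms(1) by (rule has_wirtingerE)
  obtain E where E: "(\<psi> has_derivative E) (at x)" "b = (E 1 - \<i> * E \<i>) / 2"
    using assms(2) by (rule has_wirtingerE)
  show ?thesis
    by (rule has_wirtingerI[OF has_derivative_add[OF D(1) E(1)]]) (simp add: D(2) E(2) field_simps)
qed

lemma has_wirtinger_mult:
  assumes "has_wirtinger \<phi> a x" and "has_wirtinger \<psi> b x"
  shows "has_wirtinger (\<lambda>y. \<phi> y * \<psi> y) (a * \<psi> x + \<phi> x * b) x"
proof -
  obtain D where D: "(\<phi> has_derivative D) (at x)" "a = (D 1 - \<i> * D \<i>) / 2"
    using assms(1) by (rule has_wirtingerE)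
  obtain E where E: "(\<psi> has_derivative E) (at x)" "b = (E 1 - \<i> * E \<i>) / 2"
    using assms(2) by (rule has_wirtingerE)
  show ?thesis
    by (rule has_wirtingerI[OF has_derivative_mult[OF D(1) E(1)]]) (simp add: D(2) E(2) field_simps)
qed

lemma has_wirtinger_field_derivative:
  assumes "(\<phi> has_field_derivative a) (at x)"
  shows "has_wirtinger \<phi> a x"
  using assms
  by (intro has_wirtingerI[OF has_field_derivative_imp_has_derivative]) (auto simp: algebra_simps)

lemma has_wirtinger_cmult:
  assumes "has_wirtinger \<phi> a x"
  shows "has_wirtinger (\<lambda>y. c * \<phi> y) (c * a) x"
  using has_wirtinger_mult[OF has_wirtinger_field_derivative[OF DERIV_const] assms, of c] by simp

lemma has_wirtinger_field_chain:
  assumes "has_wirtinger \<phi> a x" and "(g has_field_derivative b) (at (\<phi> x))"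
  shows "has_wirtinger (\<lambda>y. g (\<phi> y)) (b * a) x"
proof -
  obtain D where D: "(\<phi> has_derivative D) (at x)" "a = (D 1 - \<i> * D \<i>) / 2"
    using assms(1) by (rule has_wirtingerE)
  have "((\<lambda>y. g (\<phi> y)) has_derivative (\<lambda>h. b * D h)) (at x)"
    using has_derivative_compose[OF D(1) has_field_derivative_imp_has_derivative[OF assms(2)]]
    by simp
  then show ?thesis
    by (rule has_wirtingerI) (simp add: D(2) field_simps)
qed

text \<open>In general the chain rule has a second term, the derivative of \<phi> in the conjugate
  variable times \<open>\<partial>\<close> of the conjugate of \<open>F\<close>. That term vanishes
  because \<open>F\<close> is complex differentiable at \<open>x\<close>.\<close>

lemma has_wirtinger_compose:
  assumes "(F has_field_derivative b) (at x)" and "has_wirtinger \<phi> a (F x)"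
  shows "has_wirtinger (\<lambda>y. \<phi> (F y)) (a * b) x"
proof -
  obtain D where D: "(\<phi> has_derivative D) (at (F x))" "a = (D 1 - \<i> * D \<i>) / 2"
    using assms(2) by (rule has_wirtingerE)
  have lin: "linear D"
    using D(1) has_derivative_linear by blast
  \<comment> \<open>\<open>D\<close> is only real linear, so its values at \<open>b\<close> and
    \<open>b * \<i>\<close> have to be expanded in the real basis 1, \<i>.\<close>
  have Dh: "D h = Re h *\<^sub>R D 1 + Im h *\<^sub>R D \<i>" for h
  proof -
    have "h = Re h *\<^sub>R 1 + Im h *\<^sub>R \<i>"
      by (simp add: complex_eq_iff)
    then have "D h = D (Re h *\<^sub>R 1 + Im h *\<^sub>R \<i>)"
      by simp
    then show ?thesis
      by (simp only: linear_add[OF lin] linear_scale[OF lin])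
  qed
  have "((\<lambda>y. \<phi> (F y)) has_derivative (\<lambda>h. D (b * h))) (at x)"
    using has_derivative_compose[OF has_field_derivative_imp_has_derivative[OF assms(1)] D(1)]
    by simp
  then show ?thesis
  proof (rule has_wirtingerI)
    show "a * b = (D (b * 1) - \<i> * D (b * \<i>)) / 2"
      unfolding D(2) Dh[of "b * 1"] Dh[of "b * \<i>"] by (simp add: complex_eq_iff field_simps)
  qed
qed

text \<open>Locally log |h| is half the sum of log h and its conjugate, and
  \<open>\<partial>\<close> kills the conjugate. The proof avoids a branch of the logarithm by
  computing the real differential of log |h|, which is the real part of the logarithmic differential
  of \<open>h\<close>.\<close>

lemma has_wirtinger_ln_norm:
  assumes "(h has_field_derivative b) (at x)" and "h x \<noteq> 0"
  shows "has_wirtinger (\<lambda>y. of_real (ln (cmod (h y)))) (b / (2 * h x)) x"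
proof -
  have h: "(h has_derivative (\<lambda>v. b * v)) (at x)"
    by (rule has_field_derivative_imp_has_derivative[OF assms(1)])
  have "((\<lambda>y. cmod (h y)) has_derivative (\<lambda>v. inner (sgn (h x)) (b * v))) (at x)"
    using has_derivative_compose[OF h has_derivative_norm[OF assms(2)]] by (simp add: inner_commute)
  from has_derivative_of_real[OF has_derivative_ln[OF _ this], where ?'a = complex]
  have "((\<lambda>y. complex_of_real (ln (cmod (h y)))) has_derivative
      (\<lambda>v. of_real (inner (sgn (h x)) (b * v) * inverse (cmod (h x))))) (at x)"
    using assms(2) by simp
  moreover have "inner (sgn (h x)) (b * v) * inverse (cmod (h x)) = Re (b * v / h x)" for v
    by (simp add: sgn_div_norm inner_complex_def Re_divide divide_simps power2_eq_square
        cmod_power2[unfolded power2_eq_square, symmetric])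
  ultimately have "((\<lambda>y. complex_of_real (ln (cmod (h y)))) has_derivative
      (\<lambda>v. of_real (Re (b * v / h x)))) (at x)"
    by (simp only:)
  then show ?thesis
  proof (rule has_wirtingerI)
    \<comment> \<open>With this \<open>c\<close> the claim reads c = Re c - \<i> Re (\<i> c), where
      Re (\<i> c) = - Im c.\<close>
    define c where "c = b / h x"
    then have "b * \<i> / h x = \<i> * c" and "b * 1 / h x = c" and "b / (2 * h x) = c / 2"
      by simp_all
    then show "b / (2 * h x) = (of_real (Re (b * 1 / h x)) - \<i> * of_real (Re (b * \<i> / h x))) / 2"
      by (simp only:) (simp add: complex_eq_iff)
  qed
qed

section \<open>Conformal densities on plane domains\<close>

text \<open>Supplies the differentiability that the rules for \<open>has_wirtinger\<close> demand of
  log \<rho> and of its first Wirtinger derivative.\<close>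

lemma smooth_density_log_differentiable:
  assumes "smooth_on \<rho> S" and "open S" and "\<And>x. x \<in> S \<Longrightarrow> \<rho> x > 0" and "x \<in> S"
  shows "clog_metric \<rho> differentiable (at x)"
    and "\<partial> (clog_metric \<rho>) differentiable (at x)"
proof -
  have "Ck_on (Suc (Suc 0)) \<rho> S"
    using assms(1) unfolding smooth_on_def by blast
  then have diff: "\<And>y. y \<in> S \<Longrightarrow> \<rho> differentiable (at y)"
    and diff2: "\<And>v. (\<lambda>y. frechet_derivative \<rho> (at y) v) differentiable (at x)"
    using assms(4) by auto
  have clog: "(clog_metric \<rho> has_derivative
      (\<lambda>v. of_real (frechet_derivative \<rho> (at y) v * inverse (\<rho> y)))) (at y)" if "y \<in> S" for y
    unfolding clog_metric_def
    using has_derivative_of_real[OF has_derivative_ln[OF assms(3)[OF that]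
          diff[OF that, unfolded frechet_derivative_works]]] .
  then show "clog_metric \<rho> differentiable (at x)"
    using assms(4) differentiable_def by blast
  \<comment> \<open>\<open>\<partial>\<close> of log \<rho> written through the directional
    derivatives of \<rho> along 1 and \<i>. Since this holds on the open set \<open>S\<close>,
    differentiating the explicit expression suffices.\<close>
  let ?d = "\<lambda>y. of_real (frechet_derivative \<rho> (at y) 1 * inverse (\<rho> y)) / 2 -
      \<i> * of_real (frechet_derivative \<rho> (at y) \<i> * inverse (\<rho> y)) / 2"
  have eq: "?d y = \<partial> (clog_metric \<rho>) y" if "y \<in> S" for y
    using has_wirtinger_imp_wirtinger[OF has_wirtingerI[OF clog[OF that] refl]]
    by (simp add: diff_divide_distrib)
  obtain D where D: "\<And>v. ((\<lambda>y. frechet_derivative \<rho> (at y) v) has_derivative D v) (at x)"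
    using diff2 unfolding differentiable_def by metis
  note \<rho>' = diff[OF assms(4), unfolded frechet_derivative_works]
  have "\<rho> x \<noteq> 0"
    using assms(3,4) by force
  then have "\<exists>E. (?d has_derivative E) (at x)"
    by (intro exI) (rule derivative_eq_intros D \<rho>' refl | simp)+
  then obtain E where "(?d has_derivative E) (at x)" ..
  then have "(\<partial> (clog_metric \<rho>) has_derivative E) (at x)"
    by (rule has_derivative_transform_within_open[OF _ assms(2,4) eq])
  then show "\<partial> (clog_metric \<rho>) differentiable (at x)"
    using differentiable_def by blast
qed

text \<open>\<rho> is the exponential of log \<rho>, and exp is holomorphic. From here on densities
  are differentiated only through their logarithms.\<close>

lemma has_wirtinger_density:
  assumes "open S" and "x \<in> S" and "\<And>y. y \<in> S \<Longrightarrow> \<rho> y > 0"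
    and "clog_metric \<rho> differentiable (at x)"
  shows "has_wirtinger (\<lambda>y. of_real (\<rho> y)) (\<rho> x * \<partial> (clog_metric \<rho>) x) x"
proof -
  have eq: "exp (clog_metric \<rho> y) = of_real (\<rho> y)" if "y \<in> S" for y
    using assms(3)[OF that] unfolding clog_metric_def by (simp only: exp_of_real exp_ln)
  have "has_wirtinger (\<lambda>y. exp (clog_metric \<rho> y)) (exp (clog_metric \<rho> x) * \<partial> (clog_metric \<rho>) x) x"
    by (rule has_wirtinger_field_chain[OF has_wirtinger_wirtinger[OF assms(4)] DERIV_exp])
  then show ?thesis
    unfolding eq[OF assms(2)] by (rule has_wirtinger_transform[OF _ assms(1,2) eq])
qed

text \<open>The function \<open>T\<close> of the opening remark.\<close>

definition metric_pre_schwarzian ::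
  "(complex \<Rightarrow> real) \<Rightarrow> (complex \<Rightarrow> complex) \<Rightarrow> complex \<Rightarrow> complex" where
  "metric_pre_schwarzian \<sigma> F x =
     deriv (deriv F) x / deriv F x + 2 * (\<partial> (clog_metric \<sigma>) (F x) * deriv F x)"

lemma holomorphic_has_derivs:
  assumes "F holomorphic_on U" and "open U" and "x \<in> U"
  shows "(F has_field_derivative deriv F x) (at x)"
    and "(deriv F has_field_derivative deriv (deriv F) x) (at x)"
  using assms holomorphic_deriv holomorphic_derivI by blast+

lemma has_wirtinger_pre_schwarzian:
  assumes "F holomorphic_on U" and "open U" and "x \<in> U" and "deriv F x \<noteq> 0"
    and "\<partial> (clog_metric \<sigma>) differentiable (at (F x))"
  shows "has_wirtinger (metric_pre_schwarzian \<sigma> F)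
    (deriv (\<lambda>t. deriv (deriv F) t / deriv F t) x
      + 2 * (\<partial> (\<partial> (clog_metric \<sigma>)) (F x) * (deriv F x)\<^sup>2
        + \<partial> (clog_metric \<sigma>) (F x) * deriv (deriv F) x)) x"
proof -
  have "deriv F holomorphic_on U" "deriv (deriv F) holomorphic_on U"
    using assms by (auto intro!: holomorphic_deriv)
  then have "((\<lambda>t. deriv (deriv F) t / deriv F t) has_field_derivative
      deriv (\<lambda>t. deriv (deriv F) t / deriv F t) x) (at x)"
    using assms(2-4) unfolding DERIV_deriv_iff_field_differentiable
    by (intro field_differentiable_divide holomorphic_on_imp_differentiable_at[of _ U])
  note 1 = has_wirtinger_field_derivative[OF this]
  note F' = holomorphic_has_derivs[OF assms(1-3)]
  note 2 = has_wirtinger_compose[OF F'(1) has_wirtinger_wirtinger[OF assms(5)]]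
  note 3 = has_wirtinger_add[OF 1 has_wirtinger_cmult[OF has_wirtinger_mult[OF 2
        has_wirtinger_field_derivative[OF F'(2)]], of 2]]
  then show ?thesis
    by (simp add: metric_pre_schwarzian_def[abs_def] power2_eq_square mult.assoc)
qed

text \<open>Both the derivative of T and T^2/2 contain the mixed term 2 (\<partial> log \<sigma> o
  F) F'', which cancels. What is left separates into a part from F''/F' and a part from
  \<sigma>.\<close>

lemma wirtinger_pre_schwarzian:
  assumes "F holomorphic_on U" and "open U" and "x \<in> U" and "deriv F x \<noteq> 0"
    and "\<partial> (clog_metric \<sigma>) differentiable (at (F x))"
  shows "\<partial> (metric_pre_schwarzian \<sigma> F) x - (metric_pre_schwarzian \<sigma> F x)\<^sup>2 / 2 =
    schwarzian F x + (2 * \<partial> (\<partial> (clog_metric \<sigma>)) (F x) - 2 * (\<partial> (clog_metric \<sigma>) (F x))\<^sup>2)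
      * (deriv F x)\<^sup>2"
proof -
  \<comment> \<open>The derivative of F''/F' occurs on both sides and is kept opaque; expanding it
    would bring in F'''.\<close>
  define P where "P = deriv (\<lambda>t. deriv (deriv F) t / deriv F t) x"
  show ?thesis
    unfolding has_wirtinger_imp_wirtinger[OF has_wirtinger_pre_schwarzian[OF assms]]
      metric_pre_schwarzian_def schwarzian_def P_def[symmetric]
    using assms(4) by (simp add: field_simps power2_eq_square)
qed

section \<open>Peschl-Minda derivatives of orders one to three on plane domains\<close>

lemma has_wirtinger_divide_density:
  assumes "has_wirtinger \<phi> a x" and "open S" and "x \<in> S" and "\<And>y. y \<in> S \<Longrightarrow> \<rho> y > 0"
    and "clog_metric \<rho> differentiable (at x)"
  shows "has_wirtinger (\<lambda>y. \<phi> y / of_real (\<rho> y))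
    ((a - \<phi> x * \<partial> (clog_metric \<rho>) x) / of_real (\<rho> x)) x"
proof -
  have nz: "complex_of_real (\<rho> x) \<noteq> 0"
    using assms(3,4) by force
  have "has_wirtinger (\<lambda>y. inverse (of_real (\<rho> y)))
      (- (inverse (of_real (\<rho> x)) ^ Suc (Suc 0)) * (\<rho> x * \<partial> (clog_metric \<rho>) x)) x"
    by (rule has_wirtinger_field_chain[OF has_wirtinger_density[OF assms(2-5)] DERIV_inverse[OF nz]])
  from has_wirtinger_mult[OF assms(1) this] show ?thesis
    unfolding divide_inverse[symmetric]
    by (rule has_wirtinger_eq_rhs) (use nz in \<open>simp add: field_simps\<close>)
qed

text \<open>Logarithmic differentiation of (\<sigma> o F) F' / \<rho>: the bracket is the sum of the
  logarithmic derivatives of the three factors.\<close>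

lemma has_wirtinger_peschl_minda_1:
  assumes "open U" and "F holomorphic_on U" and "x \<in> U" and "deriv F x \<noteq> 0"
    and "\<And>y. y \<in> U \<Longrightarrow> \<rho> y > 0" and "clog_metric \<rho> differentiable (at x)"
    and "open V" and "F x \<in> V" and "\<And>y. y \<in> V \<Longrightarrow> \<sigma> y > 0"
    and "clog_metric \<sigma> differentiable (at (F x))"
  shows "has_wirtinger (peschl_minda \<rho> \<sigma> F 1) (peschl_minda \<rho> \<sigma> F 1 x *
    (\<partial> (clog_metric \<sigma>) (F x) * deriv F x - \<partial> (clog_metric \<rho>) x + deriv (deriv F) x / deriv F x)) x"
proof -
  have nz: "complex_of_real (\<rho> x) \<noteq> 0"
    using assms(3,5) by force
  note F' = holomorphic_has_derivs[OF assms(2,1,3)]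
  note 1 = has_wirtinger_compose[OF F'(1) has_wirtinger_density[OF assms(7-10)]]
  note 2 = has_wirtinger_mult[OF has_wirtinger_divide_density[OF 1 assms(1,3,5,6)]
      has_wirtinger_field_derivative[OF F'(2)]]
  show ?thesis
    unfolding One_nat_def peschl_minda.simps(1)
  proof (rule has_wirtinger_eq_rhs[OF 2])
    define s r a b F1 F2 where "s = complex_of_real (\<sigma> (F x))" and "r = complex_of_real (\<rho> x)"
      and "a = \<partial> (clog_metric \<rho>) x" and "b = \<partial> (clog_metric \<sigma>) (F x)"
      and "F1 = deriv F x" and "F2 = deriv (deriv F) x"
    note ab = this
    have "r \<noteq> 0" "F1 \<noteq> 0"
      using nz assms(4) by (simp_all add: ab)
    then have "(s * b * F1 - s * a) / r * F1 + s / r * F2 = s / r * F1 * (b * F1 - a + F2 / F1)"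
      by (simp add: field_simps)
    then show "(of_real (\<sigma> (F x)) * \<partial> (clog_metric \<sigma>) (F x) * deriv F x
        - of_real (\<sigma> (F x)) * \<partial> (clog_metric \<rho>) x) / of_real (\<rho> x) * deriv F x
        + of_real (\<sigma> (F x)) / of_real (\<rho> x) * deriv (deriv F) x =
      of_real (\<sigma> (F x)) / of_real (\<rho> x) * deriv F x *
        (\<partial> (clog_metric \<sigma>) (F x) * deriv F x - \<partial> (clog_metric \<rho>) x
          + deriv (deriv F) x / deriv F x)"
      unfolding ab .
  qed
qed

text \<open>The recursion adds one more copy of (\<partial> log \<sigma> o F) F' and subtracts one
  more copy of \<partial> log \<rho>. Each thus occurs twice, which explains the factors 2 in T and
  in front of \<partial> log \<rho>.\<close>

lemma peschl_minda_2:
  assumes "open U" and "F holomorphic_on U" and "x \<in> U" and "deriv F x \<noteq> 0"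
    and "\<And>y. y \<in> U \<Longrightarrow> \<rho> y > 0" and "clog_metric \<rho> differentiable (at x)"
    and "open V" and "F x \<in> V" and "\<And>y. y \<in> V \<Longrightarrow> \<sigma> y > 0"
    and "clog_metric \<sigma> differentiable (at (F x))"
  shows "peschl_minda \<rho> \<sigma> F 2 x = peschl_minda \<rho> \<sigma> F 1 x *
    (metric_pre_schwarzian \<sigma> F x - 2 * \<partial> (clog_metric \<rho>) x) / of_real (\<rho> x)"
proof -
  have nz: "complex_of_real (\<rho> x) \<noteq> 0" "complex_of_real (\<sigma> (F x)) \<noteq> 0"
    using assms(3,5,8,9) by force+
  define D where "D = peschl_minda \<rho> \<sigma> F 1"
  have W: "\<partial> D x = D x * (\<partial> (clog_metric \<sigma>) (F x) * deriv F x
      - \<partial> (clog_metric \<rho>) x + deriv (deriv F) x / deriv F x)"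
    unfolding D_def
    by (rule has_wirtinger_imp_wirtinger[OF has_wirtinger_peschl_minda_1[OF assms]])
  \<comment> \<open>The factor \<sigma>(F x) in the first Peschl-Minda derivative cancels the
    1/\<sigma> of \<open>metric_partial\<close>.\<close>
  have bD: "\<partial> (clog_metric \<sigma>) (F x) / of_real (\<sigma> (F x)) * D x =
      \<partial> (clog_metric \<sigma>) (F x) * deriv F x / of_real (\<rho> x)"
    using nz by (simp add: D_def)
  have D2: "peschl_minda \<rho> \<sigma> F 2 x = \<partial> D x / of_real (\<rho> x) +
      (- (\<partial> (clog_metric \<rho>) x / of_real (\<rho> x))
        + \<partial> (clog_metric \<sigma>) (F x) / of_real (\<sigma> (F x)) * D x) * D x"
    by (simp add: D_def numeral_2_eq_2 metric_partial_def)
  show ?thesis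
    unfolding D2 bD W D_def[symmetric] metric_pre_schwarzian_def
    using nz assms(4) by (simp add: field_simps)
qed

lemma invariant_schwarzian_plane:
  assumes "open U" and "F holomorphic_on U" and "x \<in> U" and "\<And>y. y \<in> U \<Longrightarrow> deriv F y \<noteq> 0"
    and "\<And>y. y \<in> U \<Longrightarrow> \<rho> y > 0" and "\<And>y. y \<in> U \<Longrightarrow> clog_metric \<rho> differentiable (at y)"
    and "\<partial> (clog_metric \<rho>) differentiable (at x)"
    and "open V" and "F ` U \<subseteq> V" and "\<And>y. y \<in> V \<Longrightarrow> \<sigma> y > 0"
    and "\<And>y. y \<in> V \<Longrightarrow> clog_metric \<sigma> differentiable (at y)"
    and "\<partial> (clog_metric \<sigma>) differentiable (at (F x))"
  shows "peschl_minda_quot \<rho> \<sigma> F 2 x - 3/2 * (peschl_minda_quot \<rho> \<sigma> F 1 x)\<^sup>2 =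
    (\<partial> (metric_pre_schwarzian \<sigma> F) x - (metric_pre_schwarzian \<sigma> F x)\<^sup>2 / 2
      - (2 * \<partial> (\<partial> (clog_metric \<rho>)) x - 2 * (\<partial> (clog_metric \<rho>) x)\<^sup>2)) / (of_real (\<rho> x))\<^sup>2"
proof -
  have FV: "F y \<in> V" if "y \<in> U" for y
    using assms(9) that by blast
  have nz: "complex_of_real (\<rho> x) \<noteq> 0" "complex_of_real (\<sigma> (F x)) \<noteq> 0" "deriv F x \<noteq> 0"
    using assms(3,4,5,10) FV by force+
  define a where "a = \<partial> (clog_metric \<rho>)"
  define b where "b = \<partial> (clog_metric \<sigma>) (F x)"
  define T where "T = metric_pre_schwarzian \<sigma> F"
  define D where "D = peschl_minda \<rho> \<sigma> F"
  define r where "r = complex_of_real (\<rho> x)"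
  define F1 F2 where "F1 = deriv F x" and "F2 = deriv (deriv F) x"
  have Dnz: "D 1 x \<noteq> 0"
    using nz by (simp add: D_def)
  \<comment> \<open>Needed on all of \<open>U\<close>, not only at \<open>x\<close>, because the
    third derivative differentiates this formula.\<close>
  have D2: "D 2 y = D 1 y * (T y - 2 * a y) / of_real (\<rho> y)" if "y \<in> U" for y
    unfolding D_def T_def a_def
    using assms(1,2,8) that assms(4-6,10,11) FV[OF that]
    by (intro peschl_minda_2[of U F y \<rho> V \<sigma>]) auto
  have W1: "has_wirtinger (D 1) (D 1 x * (b * F1 - a x + F2 / F1)) x"
    unfolding D_def a_def b_def F1_def F2_def
    using assms FV[OF assms(3)] by (intro has_wirtinger_peschl_minda_1[of U F x \<rho> V \<sigma>]) auto
  have WT: "has_wirtinger T (\<partial> T x) x"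
    using has_wirtinger_pre_schwarzian[OF assms(2,1,3) nz(3) assms(12)]
    unfolding T_def by (auto simp: has_wirtinger_def)
  have Wa: "has_wirtinger a (\<partial> a x) x"
    using assms(7) by (simp add: a_def has_wirtinger_def)
  have "has_wirtinger (\<lambda>y. D 1 y * (T y + (- 2) * a y) / of_real (\<rho> y))
      ((D 1 x * (b * F1 - a x + F2 / F1) * (T x + (- 2) * a x)
        + D 1 x * (\<partial> T x + (- 2) * \<partial> a x)
        - D 1 x * (T x + (- 2) * a x) * a x) / of_real (\<rho> x)) x"
    unfolding a_def
    by (rule has_wirtinger_divide_density[OF has_wirtinger_mult[OF W1 has_wirtinger_add[OF WT
            has_wirtinger_cmult[OF Wa]], unfolded a_def] assms(1,3,5) assms(6)[OF assms(3)]])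
  then have "has_wirtinger (D 2)
      ((D 1 x * (b * F1 - a x + F2 / F1) * (T x + (- 2) * a x)
        + D 1 x * (\<partial> T x + (- 2) * \<partial> a x)
        - D 1 x * (T x + (- 2) * a x) * a x) / of_real (\<rho> x)) x"
    by (rule has_wirtinger_transform[OF _ assms(1,3)]) (simp add: D2)
  note W2 = has_wirtinger_imp_wirtinger[OF this]
  have Tx: "T x = F2 / F1 + 2 * (b * F1)"
    by (simp add: T_def metric_pre_schwarzian_def F1_def F2_def b_def)
  have bD: "b / of_real (\<sigma> (F x)) * D 1 x = b * F1 / r"
    using nz by (simp add: D_def F1_def r_def)
  have "D 3 x = \<partial> (D 2) x / r + (- 2 * (a x / r) + b / of_real (\<sigma> (F x)) * D 1 x) * D 2 x"
    by (simp add: D_def numeral_3_eq_3 numeral_2_eq_2 metric_partial_def a_def b_def r_def)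
  \<comment> \<open>The four copies of \<open>a x\<close> beside \<open>T x\<close> come from
    \<open>D 1\<close>, from the division by \<rho>, and twice from the recursion. The two copies of
    \<open>b * F1\<close>, one from \<open>D 1\<close> and one from the recursion, complete F''/F'
    to \<open>T x\<close>.\<close>
  also have "\<dots> = D 1 x * (\<partial> T x - 2 * \<partial> a x + (T x - 2 * a x) * (T x - 4 * a x)) / r\<^sup>2"
    unfolding W2 D2[OF assms(3)] bD r_def[symmetric] Tx
    using nz unfolding r_def[symmetric] by (simp add: field_simps power2_eq_square)
  finally have q2: "D 3 x / D 1 x = (\<partial> T x - 2 * \<partial> a x + (T x - 2 * a x) * (T x - 4 * a x)) / r\<^sup>2"
    using Dnz by simp
  have q1: "D 2 x / D 1 x = (T x - 2 * a x) / r"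
    using Dnz D2[OF assms(3)] by (simp add: r_def)
  have q: "peschl_minda_quot \<rho> \<sigma> F 2 x = D 3 x / D 1 x"
    "peschl_minda_quot \<rho> \<sigma> F 1 x = D 2 x / D 1 x"
    by (simp_all add: peschl_minda_quot_def D_def numeral_eq_Suc)
  \<comment> \<open>The weight 3/2 removes the mixed terms: (T - 2a)(T - 4a) - 3/2 (T - 2a)^2 = -
    T^2/2 + 2 a^2.\<close>
  show ?thesis
    using nz(1) unfolding q q1 q2 r_def[symmetric] T_def[symmetric] a_def[symmetric]
    by (simp add: field_simps power2_eq_square)
qed

section \<open>Change of the target coordinate\<close>

lemma deriv_compose_twice:
  assumes "F holomorphic_on U" and "open U" and "x \<in> U"
    and "g holomorphic_on V" and "open V" and "F ` U \<subseteq> V"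
    and "\<And>y. y \<in> U \<Longrightarrow> G y = g (F y)"
  shows "deriv G x = deriv g (F x) * deriv F x"
    and "deriv (deriv G) x =
      deriv (deriv g) (F x) * (deriv F x)\<^sup>2 + deriv g (F x) * deriv (deriv F) x"
proof -
  have FV: "F y \<in> V" if "y \<in> U" for y
    using assms(6) that by blast
  \<comment> \<open>Proved throughout \<open>U\<close> so that it can be differentiated once more at
    \<open>x\<close>.\<close>
  have dG: "deriv G y = deriv g (F y) * deriv F y" if "y \<in> U" for y
  proof (rule DERIV_imp_deriv)
    have "((\<lambda>y. g (F y)) has_field_derivative deriv g (F y) * deriv F y) (at y)"
      by (rule DERIV_chain2[OF holomorphic_has_derivs(1)[OF assms(4,5) FV[OF that]]
            holomorphic_has_derivs(1)[OF assms(1,2) that]])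
    then show "(G has_field_derivative deriv g (F y) * deriv F y) (at y)"
      by (rule has_field_derivative_transform_within_open[OF _ assms(2) that]) (simp add: assms(7))
  qed
  then show "deriv G x = deriv g (F x) * deriv F x"
    using assms(3) by blast
  show "deriv (deriv G) x =
      deriv (deriv g) (F x) * (deriv F x)\<^sup>2 + deriv g (F x) * deriv (deriv F) x"
  proof (rule DERIV_imp_deriv)
    note F' = holomorphic_has_derivs[OF assms(1-3)]
    note g'' = holomorphic_has_derivs(2)[OF assms(4,5) FV[OF assms(3)]]
    have "((\<lambda>y. deriv g (F y) * deriv F y) has_field_derivative
        deriv (deriv g) (F x) * (deriv F x)\<^sup>2 + deriv g (F x) * deriv (deriv F) x) (at x)"
      using DERIV_mult[OF DERIV_chain2[OF g'' F'(1)] F'(2)]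
      by (simp add: power2_eq_square algebra_simps)
    then show "(deriv G has_field_derivative
        deriv (deriv g) (F x) * (deriv F x)\<^sup>2 + deriv g (F x) * deriv (deriv F) x) (at x)"
      by (rule has_field_derivative_transform_within_open[OF _ assms(2,3)]) (simp add: dG)
  qed
qed

text \<open>Here log \<sigma> = log \<tau> o g + log |g'|. By the chain rule G''/G' exceeds F''/F'
  by ((g''/g') o F) F', and this is exactly what the summand log |g'| contributes to 2 (\<partial>
  log \<sigma> o F) F'.\<close>

lemma metric_pre_schwarzian_compose:
  assumes "F holomorphic_on U" and "open U" and "x \<in> U" and "deriv F x \<noteq> 0"
    and "g holomorphic_on V" and "open V" and "F ` U \<subseteq> V"
    and "\<And>y. y \<in> U \<Longrightarrow> G y = g (F y)"
    and "\<And>y. y \<in> V \<Longrightarrow> \<sigma> y = \<tau> (g y) * cmod (deriv g y)"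
    and "\<And>y. y \<in> V \<Longrightarrow> \<sigma> y > 0" and "\<And>y. y \<in> V \<Longrightarrow> \<tau> (g y) > 0"
    and "clog_metric \<tau> differentiable (at (g (F x)))"
  shows "metric_pre_schwarzian \<tau> G x = metric_pre_schwarzian \<sigma> F x"
proof -
  have FV: "F x \<in> V"
    using assms(3,7) by blast
  \<comment> \<open>Positivity of \<sigma> forces g' to be nonzero, so injectivity of
    \<open>g\<close> does not enter.\<close>
  have nz: "deriv g y \<noteq> 0" if "y \<in> V" for y
    using assms(9,10)[OF that] by auto
  note g' = holomorphic_has_derivs[OF assms(5,6) FV]
  note W = has_wirtinger_add[OF has_wirtinger_compose[OF g'(1) has_wirtinger_wirtinger[OF assms(12)]]
      has_wirtinger_ln_norm[OF g'(2) nz[OF FV]]]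
  have "has_wirtinger (clog_metric \<sigma>) (\<partial> (clog_metric \<tau>) (g (F x)) * deriv g (F x)
      + deriv (deriv g) (F x) / (2 * deriv g (F x))) (F x)"
    by (rule has_wirtinger_transform[OF W assms(6) FV])
      (use assms(9,11) nz in \<open>simp add: clog_metric_def ln_mult_pos\<close>)
  note W' = has_wirtinger_imp_wirtinger[OF this]
  have dG: "deriv G x = deriv g (F x) * deriv F x"
    by (rule deriv_compose_twice(1)[OF assms(1-3,5-8)])
  have ddG: "deriv (deriv G) x =
      deriv (deriv g) (F x) * (deriv F x)\<^sup>2 + deriv g (F x) * deriv (deriv F) x"
    by (rule deriv_compose_twice(2)[OF assms(1-3,5-8)])
  show ?thesis
    unfolding metric_pre_schwarzian_def W' dG ddG assms(8)[OF assms(3)]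
    using nz[OF FV] assms(4) by (simp add: field_simps power2_eq_square)
qed

text \<open>For the Moebius map g''/g' = -2c/(cy + d), so G''/G' = F''/F' - 2cF'/(cF + d). The terms
  created by the correction in the derivative and in half the square coincide and cancel.\<close>

lemma schwarzian_moebius_compose:
  assumes "F holomorphic_on U" and "open U" and "x \<in> U" and "deriv F x \<noteq> 0"
    and "moebius_on (F ` U) T" and "\<And>y. y \<in> U \<Longrightarrow> G y = T (F y)"
  shows "schwarzian G x = schwarzian F x"
proof -
  obtain a b c d where det: "a * d - b * c \<noteq> 0"
    and T: "\<And>y. y \<in> U \<Longrightarrow> c * F y + d \<noteq> 0 \<and> T (F y) = (a * F y + b) / (c * F y + d)"
    using assms(5) unfolding moebius_on_def by blast
  define g where "g = (\<lambda>y. (a * y + b) / (c * y + d))"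
  define V where "V = {y. c * y + d \<noteq> 0}"
  have oV: "open V"
    unfolding V_def by (intro open_Collect_neq continuous_intros)
  have g1: "(g has_field_derivative (a * d - b * c) / (c * y + d)\<^sup>2) (at y)" if "y \<in> V" for y
    using that unfolding g_def V_def
    by (auto intro!: derivative_eq_intros simp: field_simps power2_eq_square)
  then have gV: "g holomorphic_on V"
    using oV by (auto simp: holomorphic_on_open)
  have dg: "deriv g y = (a * d - b * c) / (c * y + d)\<^sup>2" if "y \<in> V" for y
    using g1[OF that] by (rule DERIV_imp_deriv)
  \<comment> \<open>Written as a multiple of \<open>deriv g\<close>, so that \<open>deriv g\<close>
    drops out of the quotient G''/G'.\<close>
  have ddg: "deriv (deriv g) y = - 2 * c / (c * y + d) * deriv g y" if "y \<in> V" for y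
  proof (rule DERIV_imp_deriv)
    have "((\<lambda>y. (a * d - b * c) / (c * y + d)\<^sup>2) has_field_derivative
        - 2 * c / (c * y + d) * deriv g y) (at y)"
      unfolding dg[OF that] using that unfolding V_def
      by (auto intro!: derivative_eq_intros simp: divide_simps power2_eq_square)
    then show "(deriv g has_field_derivative - 2 * c / (c * y + d) * deriv g y) (at y)"
      by (rule has_field_derivative_transform_within_open[OF _ oV that]) (simp add: dg)
  qed
  have FV: "F ` U \<subseteq> V"
    using T by (auto simp: V_def)
  have G: "G y = g (F y)" if "y \<in> U" for y
    using T[OF that] assms(6)[OF that] by (simp add: g_def)
  \<comment> \<open>The formula for G''/G' holds where F' is nonzero. This set is open, so the
    formula may be differentiated at \<open>x\<close>.\<close>
  define U' where "U' = {y \<in> U. deriv F y \<noteq> 0}"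
  have hF': "deriv F holomorphic_on U"
    using assms(1,2) by (rule holomorphic_deriv)
  have "open (U \<inter> deriv F -` (- {0}))"
    using hF' assms(2) by (intro continuous_open_preimage holomorphic_on_imp_continuous_on) auto
  moreover have "U' = U \<inter> deriv F -` (- {0})"
    by (auto simp: U'_def)
  ultimately have oU': "open U'" by simp
  have xU': "x \<in> U'"
    using assms(3,4) by (simp add: U'_def)
  let ?P = "\<lambda>t. deriv (deriv F) t / deriv F t"
  let ?Q = "\<lambda>t. ?P t - 2 * c * deriv F t / (c * F t + d)"
  have Q: "deriv (deriv G) y / deriv G y = ?Q y" if "y \<in> U'" for y
  proof -
    have y: "y \<in> U" "deriv F y \<noteq> 0" "F y \<in> V" "c * F y + d \<noteq> 0"
      using that FV T by (auto simp: U'_def)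
    have dG: "deriv G y = deriv g (F y) * deriv F y"
      by (rule deriv_compose_twice(1)[OF assms(1,2) y(1) gV oV FV G])
    have ddG: "deriv (deriv G) y =
        deriv (deriv g) (F y) * (deriv F y)\<^sup>2 + deriv g (F y) * deriv (deriv F) y"
      by (rule deriv_compose_twice(2)[OF assms(1,2) y(1) gV oV FV G])
    \<comment> \<open>To be read with \<open>e\<close> = cF(y) + d, \<open>k\<close> = g'(F(y)),
      \<open>m\<close> = F'(y) and \<open>n\<close> = F''(y).\<close>
    have "(- 2 * c / e * k * m\<^sup>2 + k * n) / (k * m) = n / m - 2 * c * m / e"
      if "e \<noteq> 0" "k \<noteq> 0" "m \<noteq> 0" for e k m n :: complex
      using that by (simp add: field_simps power2_eq_square)
    moreover have "deriv g (F y) \<noteq> 0"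
      using det dg y by simp
    ultimately show ?thesis
      unfolding dG ddG ddg[OF y(3)] using y by blast
  qed
  have x: "c * F x + d \<noteq> 0"
    using T assms(3) by blast
  have "deriv (deriv F) holomorphic_on U"
    using hF' assms(2) by (rule holomorphic_deriv)
  then have P': "(?P has_field_derivative deriv ?P x) (at x)"
    using hF' assms(2-4) unfolding DERIV_deriv_iff_field_differentiable
    by (intro field_differentiable_divide holomorphic_on_imp_differentiable_at[of _ U])
  note F' = holomorphic_has_derivs[OF assms(1-3)]
  have "(?Q has_field_derivative deriv ?P x
      - (2 * c * deriv (deriv F) x / (c * F x + d) - 2 * c\<^sup>2 * (deriv F x)\<^sup>2 / (c * F x + d)\<^sup>2)) (at x)"
    by (rule derivative_eq_intros P' F' refl x)+
      (use x in \<open>simp add: divide_simps power2_eq_square; simp add: algebra_simps\<close>)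
  then have "((\<lambda>t. deriv (deriv G) t / deriv G t) has_field_derivative deriv ?P x
      - (2 * c * deriv (deriv F) x / (c * F x + d) - 2 * c\<^sup>2 * (deriv F x)\<^sup>2 / (c * F x + d)\<^sup>2)) (at x)"
    by (rule has_field_derivative_transform_within_open[OF _ oU' xU']) (simp add: Q)
  note Q' = DERIV_imp_deriv[OF this]
  show ?thesis
    unfolding schwarzian_def Q' Q[OF xU'] using x assms(4)
    by (simp add: divide_simps power2_eq_square) (simp add: algebra_simps)
qed

section \<open>Charts\<close>

lemma complex_chart_open_image:
  assumes "complex_chart X z" and "openin X A"
  shows "open (snd z ` (fst z \<inter> A))"
proof -
  have "openin (subtopology X (fst z)) (fst z \<inter> A)"
    using assms(2) by (metis Int_commute openin_subtopology_Int)
  then have "openin (top_of_set (snd z ` fst z)) (snd z ` (fst z \<inter> A))"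
    using assms(1) unfolding complex_chart_def
    by (metis homeomorphic_imp_open_map open_map_def)
  then show ?thesis
    using assms(1) openin_open_eq unfolding complex_chart_def by blast
qed

lemma complex_chart_inj:
  assumes "complex_chart X z"
  shows "inj_on (snd z) (fst z)"
proof -
  have "topspace (subtopology X (fst z)) = fst z"
    using assms openin_subset by (fastforce simp: complex_chart_def)
  then show ?thesis
    using assms homeomorphic_imp_injective_map unfolding complex_chart_def by metis
qed

lemma in_coords_apply:
  assumes "complex_chart X z" and "q \<in> fst z"
  shows "in_coords z w f (snd z q) = snd w (f q)"
  using assms complex_chart_inj by (fastforce simp: in_coords_def)

lemma complex_chart_open_preimage:
  assumes "complex_chart X z" and "continuous_map X Y f" and "openin Y B"
  shows "open (snd z ` {q \<in> fst z. f q \<in> B})"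
proof -
  have "fst z \<subseteq> topspace X"
    using assms(1) openin_subset unfolding complex_chart_def by blast
  then have "{q \<in> fst z. f q \<in> B} = fst z \<inter> {q \<in> topspace X. f q \<in> B}"
    by blast
  moreover have "openin X {q \<in> topspace X. f q \<in> B}"
    using assms(2,3) by (rule openin_continuous_map_preimage)
  ultimately show ?thesis
    using complex_chart_open_image[OF assms(1)] by simp
qed

section \<open>Projective atlases and holomorphy of their transition maps\<close>

lemma moebius_on_holomorphic:
  assumes "moebius_on C T" and "open C"
  shows "T holomorphic_on C"
proof -
  obtain a b c d where T: "\<And>x. x \<in> C \<Longrightarrow> c * x + d \<noteq> 0 \<and> T x = (a * x + b) / (c * x + d)"
    using assms(1) unfolding moebius_on_def by blast
  have "(\<lambda>x. (a * x + b) / (c * x + d)) holomorphic_on C"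
    by (intro holomorphic_intros) (use T in auto)
  then show ?thesis
    using T holomorphic_cong[of C C T "\<lambda>x. (a * x + b) / (c * x + d)"] by simp
qed

lemma projective_atlas_complex_chart:
  "projective_atlas X \<A> \<Longrightarrow> z \<in> \<A> \<Longrightarrow> complex_chart X z"
  unfolding projective_atlas_def by blast

text \<open>The Moebius coefficients may change from one component of the overlap to the next.
  Components of an open plane set are open, so holomorphy glues.\<close>

lemma projective_atlas_transition_holomorphic:
  assumes "projective_atlas X \<A>" and "z \<in> \<A>" and "w \<in> \<A>"
  shows "transition z w holomorphic_on snd z ` (fst z \<inter> fst w)"
proof -
  let ?S = "snd z ` (fst z \<inter> fst w)"
  have op: "open ?S"
    using assms complex_chart_open_image unfolding projective_atlas_def complex_chart_def by metis
  have C: "transition z w holomorphic_on C" "open C" if "C \<in> components ?S" for C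
  proof -
    show "open C"
      using op that by (rule open_components)
    moreover have "moebius_on C (transition z w)"
      using assms that unfolding projective_atlas_def by blast
    ultimately show "transition z w holomorphic_on C"
      by (simp add: moebius_on_holomorphic)
  qed
  have "transition z w holomorphic_on \<Union> (components ?S)"
    using C by (intro holomorphic_on_UN_open[where A = "\<lambda>C. C", simplified]) auto
  then show ?thesis
    by simp
qed

text \<open>All coordinates of a projective structure are compared through the charts of one
  representative atlas.\<close>

lemma projective_surface_atlas:
  assumes "projective_surface X \<P>"
  shows "\<exists>\<A>. projective_atlas X \<A> \<and> (\<forall>c\<in>\<A>. projective_coord \<P> c) \<and>
    (\<forall>z. projective_coord \<P> z \<longrightarrow> (\<exists>\<B>. projective_atlas X (\<A> \<union> \<B>) \<and> z \<in> \<B>))"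
proof -
  obtain \<A> where A: "projective_atlas X \<A>" "\<P> = projective_equiv X `` {\<A>}"
    using assms unfolding projective_surface_def by (auto elim!: quotientE)
  then have "(\<A>, \<A>) \<in> projective_equiv X"
    by (simp add: projective_equiv_def)
  then show ?thesis
    using A by (intro exI[of _ \<A>]) (auto simp: projective_coord_def projective_equiv_def)
qed

text \<open>\<open>z\<close> and \<open>w\<close> may lie in different atlases of the class, each
  compatible with the representative. Near a common point the transition therefore factors through a
  chart \<open>c\<close> of the representative, on the triple overlap.\<close>

lemma projective_coord_transition_holomorphic:
  assumes "projective_surface X \<P>" and "projective_coord \<P> z" and "projective_coord \<P> w"
  shows "transition z w holomorphic_on snd z ` (fst z \<inter> fst w)"
proof -
  obtain \<A> where at: "projective_atlas X \<A>"
    and mem: "\<And>z. projective_coord \<P> z \<Longrightarrow> \<exists>\<B>. projective_atlas X (\<A> \<union> \<B>) \<and> z \<in> \<B>"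
    using projective_surface_atlas[OF assms(1)] by blast
  obtain \<B> \<C> where B: "projective_atlas X (\<A> \<union> \<B>)" "z \<in> \<B>"
    and C: "projective_atlas X (\<A> \<union> \<C>)" "w \<in> \<C>"
    using mem[OF assms(2)] mem[OF assms(3)] by blast
  have z: "complex_chart X z" and w: "complex_chart X w"
    by (rule projective_atlas_complex_chart[OF B(1)], use B(2) in simp)
      (rule projective_atlas_complex_chart[OF C(1)], use C(2) in simp)
  have "transition z w field_differentiable (at (snd z q))" if q: "q \<in> fst z \<inter> fst w" for q
  proof -
    have "q \<in> topspace X"
      using q z openin_subset unfolding complex_chart_def by blast
    then obtain c where c: "c \<in> \<A>" "q \<in> fst c"
      using at unfolding projective_atlas_def by blast
    then have cc: "complex_chart X c"
      using projective_atlas_complex_chart[OF at] by blast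
    let ?U = "snd z ` (fst z \<inter> (fst w \<inter> fst c))"
    have "open ?U"
      by (rule complex_chart_open_image[OF z]) (use w cc in \<open>auto simp: complex_chart_def\<close>)
    have "transition z c holomorphic_on ?U"
      using projective_atlas_transition_holomorphic[OF B(1), of z c] B(2) c
      by (auto elim: holomorphic_on_subset)
    moreover have "transition c w holomorphic_on snd c ` (fst c \<inter> fst w)"
      using projective_atlas_transition_holomorphic[OF C(1), of c w] C(2) c by auto
    moreover have "transition z c ` ?U \<subseteq> snd c ` (fst c \<inter> fst w)"
      by (auto simp: in_coords_apply[OF z])
    ultimately have "transition c w \<circ> transition z c holomorphic_on ?U"
      by (rule holomorphic_on_compose_gen)
    moreover have "(transition c w \<circ> transition z c) y = transition z w y" if "y \<in> ?U" for y
      using that by (auto simp: in_coords_apply[OF z] in_coords_apply[OF cc])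
    ultimately have "transition z w holomorphic_on ?U"
      by (rule holomorphic_transform)
    then show ?thesis
      using \<open>open ?U\<close> q c by (intro holomorphic_on_imp_differentiable_at) auto
  qed
  then show ?thesis
    by (auto simp: holomorphic_on_def intro: field_differentiable_at_within)
qed

text \<open>Metrics and holomorphic maps are specified through \<open>local_coord\<close>; this
  makes them available in projective coordinates.\<close>

lemma projective_coord_imp_local_coord:
  assumes "projective_surface X \<P>" and "projective_coord \<P> z"
  shows "local_coord X \<P> z"
proof -
  have "complex_chart X z"
  proof -
    obtain \<A> \<B> where "projective_atlas X (\<A> \<union> \<B>)" "z \<in> \<B>"
      using projective_surface_atlas[OF assms(1)] assms(2) by blast
    then show ?thesis
      unfolding projective_atlas_def by blast
  qed
  moreover have "transition w z holomorphic_on snd w ` (fst z \<inter> fst w)"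
    if "projective_coord \<P> w" for w
    using projective_coord_transition_holomorphic[OF assms(1) that assms(2)] by (simp add: Int_commute)
  ultimately show ?thesis
    using projective_coord_transition_holomorphic[OF assms] unfolding local_coord_def by blast
qed

section \<open>Comparison of target coordinates on surfaces\<close>

text \<open>The set \<open>B\<close> serves to cut the source down to points that \<open>f\<close>
  sends into the overlap of two target charts, where the expressions of \<open>f\<close> in both can
  be compared.\<close>

lemma in_coords_holomorphic:
  assumes "holomorphic_surface_map X \<P> Y \<Q> f"
    and "local_coord X \<P> z" and "local_coord Y \<Q> w" and "openin Y B" and "B \<subseteq> fst w"
  shows "open (snd z ` {q \<in> fst z. f q \<in> B})"
    and "in_coords z w f holomorphic_on snd z ` {q \<in> fst z. f q \<in> B}"
    and "in_coords z w f ` snd z ` {q \<in> fst z. f q \<in> B} \<subseteq> snd w ` (fst w \<inter> B)"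
proof -
  have z: "complex_chart X z"
    using assms(2) by (simp add: local_coord_def)
  show "open (snd z ` {q \<in> fst z. f q \<in> B})"
    using assms(1) unfolding holomorphic_surface_map_def
    by (intro complex_chart_open_preimage[OF z _ assms(4)]) blast
  show "in_coords z w f holomorphic_on snd z ` {q \<in> fst z. f q \<in> B}"
    using assms(1-3,5) unfolding holomorphic_surface_map_def
    by (blast intro: holomorphic_on_subset)
  show "in_coords z w f ` snd z ` {q \<in> fst z. f q \<in> B} \<subseteq> snd w ` (fst w \<inter> B)"
    using assms(5) by (auto simp: in_coords_apply[OF z])
qed

lemma conformal_metric_log_differentiable:
  assumes "conformal_metric X \<P> \<rho>" and "local_coord X \<P> z" and "x \<in> snd z ` fst z"
  shows "clog_metric (\<rho> z) differentiable (at x)"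
    and "\<partial> (clog_metric (\<rho> z)) differentiable (at x)"
    and "\<rho> z x > 0"
proof -
  have "open (snd z ` fst z)"
    using assms(2) by (simp add: local_coord_def complex_chart_def)
  moreover have "smooth_on (\<rho> z) (snd z ` fst z)" "\<And>x. x \<in> snd z ` fst z \<Longrightarrow> \<rho> z x > 0"
    using assms(1,2) unfolding conformal_metric_def by blast+
  ultimately show "clog_metric (\<rho> z) differentiable (at x)"
    "\<partial> (clog_metric (\<rho> z)) differentiable (at x)" "\<rho> z x > 0"
    using assms(3) smooth_density_log_differentiable by blast+
qed

text \<open>One of the two coordinates must be projective because \<open>local_coord\<close> compares only with
  projective coordinates.\<close>

lemma change_target_coord:
  assumes "conformal_metric Y \<Q> \<sigma>" and "holomorphic_surface_map X \<P> Y \<Q> f"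
    and "local_coord X \<P> z" and "local_coord Y \<Q> w" and "local_coord Y \<Q> v"
    and "projective_coord \<Q> v"
    and "p \<in> fst z" and "f p \<in> fst w" and "f p \<in> fst v"
    and "deriv (in_coords z w f) (snd z p) \<noteq> 0"
  shows "deriv (in_coords z v f) (snd z p) \<noteq> 0"
    and "metric_pre_schwarzian (\<sigma> v) (in_coords z v f) (snd z p) =
      metric_pre_schwarzian (\<sigma> w) (in_coords z w f) (snd z p)"
proof -
  let ?B = "fst w \<inter> fst v" and ?g = "transition w v"
  let ?U = "snd z ` {q \<in> fst z. f q \<in> ?B}" and ?V = "snd w ` ?B"
  have z: "complex_chart X z" and w: "complex_chart Y w" and v: "complex_chart Y v"
    using assms(3-5) by (simp_all add: local_coord_def)
  have B: "openin Y ?B"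
    using w v by (auto simp: complex_chart_def)
  note U = in_coords_holomorphic[OF assms(2-4) B Int_lower1]
  have V: "open ?V"
    using complex_chart_open_image[OF w] v by (simp add: complex_chart_def)
  have g: "?g holomorphic_on ?V"
    using assms(4,6) unfolding local_coord_def by blast
  have x: "snd z p \<in> ?U"
    using assms(7-9) by blast
  have sub: "in_coords z w f ` ?U \<subseteq> ?V"
    using U(3) by (simp add: Int_absorb1)
  have comp: "in_coords z v f y = ?g (in_coords z w f y)" if "y \<in> ?U" for y
    using that by (auto simp: in_coords_apply[OF z] in_coords_apply[OF w])
  have metr: "\<sigma> w y = \<sigma> v (?g y) * cmod (deriv ?g y)" if yV: "y \<in> ?V" for y
  proof -
    obtain q where "q \<in> ?B" and y: "y = snd w q"
      using yV by blast
    then have "\<sigma> w (snd w q) = \<sigma> v (snd v q) * cmod (deriv ?g (snd w q))"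
      using assms(1,4,5) unfolding conformal_metric_def by blast
    then show ?thesis
      using \<open>q \<in> ?B\<close> by (simp add: y in_coords_apply[OF w])
  qed
  have pos: "\<sigma> w y > 0" "\<sigma> v (?g y) > 0" "clog_metric (\<sigma> v) differentiable (at (?g y))"
    if "y \<in> ?V" for y
  proof -
    have "y \<in> snd w ` fst w" "?g y \<in> snd v ` fst v"
      using that by (auto simp: in_coords_apply[OF w])
    then show "\<sigma> w y > 0" "\<sigma> v (?g y) > 0" "clog_metric (\<sigma> v) differentiable (at (?g y))"
      using conformal_metric_log_differentiable[OF assms(1,4)]
        conformal_metric_log_differentiable[OF assms(1,5)] by blast+
  qed
  have xV: "in_coords z w f (snd z p) \<in> ?V"
    using sub x by blast
  \<comment> \<open>The transformation rule of the metric again excludes a critical point of the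
    transition.\<close>
  have "deriv ?g (in_coords z w f (snd z p)) \<noteq> 0"
    using metr[OF xV] pos(1)[OF xV] by auto
  moreover have "deriv (in_coords z v f) (snd z p) =
      deriv ?g (in_coords z w f (snd z p)) * deriv (in_coords z w f) (snd z p)"
    by (rule deriv_compose_twice(1)[OF U(2,1) x g V sub comp])
  ultimately show "deriv (in_coords z v f) (snd z p) \<noteq> 0"
    using assms(10) by (metis mult_eq_0_iff)
  show "metric_pre_schwarzian (\<sigma> v) (in_coords z v f) (snd z p) =
      metric_pre_schwarzian (\<sigma> w) (in_coords z w f) (snd z p)"
    by (rule metric_pre_schwarzian_compose[OF U(2,1) x assms(10) g V sub comp metr pos(1,2)
          pos(3)[OF xV]])
qed

text \<open>Within one atlas the transition from \<open>w\<close> to \<open>c\<close> is Moebius on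
  each component of the overlap, so Moebius invariance of the Schwarzian applies near
  \<open>p\<close>.\<close>

lemma schwarzian_map_atlas:
  assumes "holomorphic_surface_map X \<P> Y \<Q> f"
    and "local_coord X \<P> z" and "local_coord Y \<Q> w"
    and "projective_atlas Y \<A>" and "w \<in> \<A>" and "c \<in> \<A>"
    and "p \<in> fst z" and "f p \<in> fst w" and "f p \<in> fst c"
    and "deriv (in_coords z w f) (snd z p) \<noteq> 0"
  shows "schwarzian_map f z c (snd z p) = schwarzian_map f z w (snd z p)"
proof -
  let ?B = "fst w \<inter> fst c"
  let ?U = "snd z ` {q \<in> fst z. f q \<in> ?B}" and ?V = "snd w ` ?B"
  let ?F = "in_coords z w f"
  have z: "complex_chart X z" and w: "complex_chart Y w"
    using assms(2,3) by (simp_all add: local_coord_def)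
  have c: "complex_chart Y c"
    using assms(4,6) unfolding projective_atlas_def by blast
  have B: "openin Y ?B"
    using w c by (auto simp: complex_chart_def)
  note U = in_coords_holomorphic[OF assms(1-3) B Int_lower1]
  have V: "open ?V"
    using complex_chart_open_image[OF w] c by (simp add: complex_chart_def)
  have x: "snd z p \<in> ?U"
    using assms(7-9) by blast
  have sub: "?F ` ?U \<subseteq> ?V"
    using U(3) by (simp add: Int_absorb1)
  \<comment> \<open>Fixed coefficients are guaranteed only on a single component, so the source is
    shrunk to the preimage of the one containing the image of \<open>p\<close>.\<close>
  define C where "C = connected_component_set ?V (?F (snd z p))"
  have xV: "?F (snd z p) \<in> ?V"
    using sub x by blast
  then have C: "C \<in> components ?V" and xC: "?F (snd z p) \<in> C"
    unfolding C_def by (auto simp: components_def)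
  have oC: "open C"
    by (rule open_components[OF V C])
  let ?U' = "?U \<inter> ?F -` C"
  have U': "open ?U'"
    using U(1,2) oC by (intro continuous_open_preimage holomorphic_on_imp_continuous_on) auto
  have hol: "?F holomorphic_on ?U'"
    using U(2) by (rule holomorphic_on_subset) auto
  have "moebius_on C (transition w c)"
    using assms(4-6) C unfolding projective_atlas_def by blast
  then have moeb: "moebius_on (?F ` ?U') (transition w c)"
    unfolding moebius_on_def by fast
  have comp: "in_coords z c f y = transition w c (?F y)" if "y \<in> ?U'" for y
    using that by (auto simp: in_coords_apply[OF z] in_coords_apply[OF w])
  show ?thesis
    unfolding schwarzian_map_def
    by (rule schwarzian_moebius_compose[OF hol U' _ assms(10) moeb comp]) (use x xC in auto)
qed

text \<open>The comparison goes from \<open>w\<close> to \<open>v\<close> through a chart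
  \<open>c\<close> of the representative atlas around \<open>f p\<close>, since each of
  \<open>w\<close> and \<open>v\<close> shares an atlas with \<open>c\<close>.\<close>

lemma schwarzian_map_projective_coord:
  assumes "projective_surface Y \<Q>" and "conformal_metric Y \<Q> \<sigma>"
    and "holomorphic_surface_map X \<P> Y \<Q> f" and "local_coord X \<P> z"
    and "projective_coord \<Q> w" and "projective_coord \<Q> v"
    and "p \<in> fst z" and "f p \<in> fst w" and "f p \<in> fst v"
    and "deriv (in_coords z w f) (snd z p) \<noteq> 0"
  shows "schwarzian_map f z v (snd z p) = schwarzian_map f z w (snd z p)"
proof -
  obtain \<A> where at: "projective_atlas Y \<A>"
    and mem: "\<And>z. projective_coord \<Q> z \<Longrightarrow> \<exists>\<B>. projective_atlas Y (\<A> \<union> \<B>) \<and> z \<in> \<B>"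
    and coord: "\<And>c. c \<in> \<A> \<Longrightarrow> projective_coord \<Q> c"
    using projective_surface_atlas[OF assms(1)] by blast
  obtain \<B> \<C> where B: "projective_atlas Y (\<A> \<union> \<B>)" "w \<in> \<B>"
    and C: "projective_atlas Y (\<A> \<union> \<C>)" "v \<in> \<C>"
    using mem[OF assms(5)] mem[OF assms(6)] by blast
  note loc = projective_coord_imp_local_coord[OF assms(1)]
  have "f p \<in> topspace Y"
    using assms(8) loc[OF assms(5)] openin_subset unfolding local_coord_def complex_chart_def by blast
  then obtain c where c: "c \<in> \<A>" "f p \<in> fst c"
    using at unfolding projective_atlas_def by blast
  have pc: "projective_coord \<Q> c"
    using coord c(1) .
  note change = change_target_coord(1)[OF assms(2-4)]
  have "schwarzian_map f z c (snd z p) = schwarzian_map f z w (snd z p)"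
    using B c assms(7-10) by (intro schwarzian_map_atlas[OF assms(3,4) loc[OF assms(5)] B(1)]) auto
  \<comment> \<open>The second comparison starts from \<open>c\<close>, so nonvanishing of the
    derivative has to be carried from \<open>w\<close> to \<open>c\<close> first.\<close>
  moreover have "deriv (in_coords z c f) (snd z p) \<noteq> 0"
    using change[OF loc[OF assms(5)] loc[OF pc] pc assms(7,8) c(2) assms(10)] .
  then have "schwarzian_map f z v (snd z p) = schwarzian_map f z c (snd z p)"
    using C c assms(7-9) by (intro schwarzian_map_atlas[OF assms(3,4) loc[OF pc] C(1)]) auto
  ultimately show ?thesis
    by simp
qed

section \<open>The identity on surfaces\<close>

theorem theorem4p6:
  fixes R :: "'a topology" and R' :: "'b topology"
    and \<P> :: "'a chart set set" and \<P>' :: "'b chart set set"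
    and \<rho> :: "'a chart \<Rightarrow> complex \<Rightarrow> real" and \<sigma> :: "'b chart \<Rightarrow> complex \<Rightarrow> real"
    and f :: "'a \<Rightarrow> 'b" and p :: 'a
    and z :: "'a chart" and w w\<^sub>1 w\<^sub>2 :: "'b chart"
  assumes "projective_surface R \<P>" and "projective_surface R' \<P>'"
    and "conformal_metric R \<P> \<rho>" and "conformal_metric R' \<P>' \<sigma>"
    and "holomorphic_surface_map R \<P> R' \<P>' f"
    and "\<not> f constant_on topspace R"
    (* one projective coordinate z of R; on R', any local coordinate w for the invariant Schwarzian
       and any projective coordinates w1, w2 for the two quadratic differentials *)
    and "projective_coord \<P> z" and "p \<in> fst z"
    and "local_coord R' \<P>' w" and "f p \<in> fst w"
    and "projective_coord \<P>' w\<^sub>1" and "f p \<in> fst w\<^sub>1"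
    and "projective_coord \<P>' w\<^sub>2" and "f p \<in> fst w\<^sub>2"
    and "deriv (in_coords z w f) (snd z p) \<noteq> 0"
  shows "invariant_schwarzian \<rho> \<sigma> f z w (snd z p) =
    (schwarzian_map f z w\<^sub>1 (snd z p)
      + pullback_qd f (schwarzian_metric \<sigma>) z w\<^sub>2 (snd z p)
      - schwarzian_metric \<rho> z (snd z p)) / (complex_of_real (\<rho> z (snd z p)))\<^sup>2"
proof -
  let ?\<zeta> = "snd z p" and ?F = "in_coords z w f" and ?G = "in_coords z w\<^sub>2 f"
  let ?T = "metric_pre_schwarzian (\<sigma> w) ?F" and ?T\<^sub>2 = "metric_pre_schwarzian (\<sigma> w\<^sub>2) ?G"
  note z = projective_coord_imp_local_coord[OF assms(1,7)]
  note w\<^sub>2 = projective_coord_imp_local_coord[OF assms(2,13)]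
  have charts: "complex_chart R z" "complex_chart R' w" "complex_chart R' w\<^sub>2"
    using z assms(9) w\<^sub>2 by (simp_all add: local_coord_def)
  let ?B = "fst w \<inter> fst w\<^sub>2"
  let ?U = "snd z ` {q \<in> fst z. f q \<in> ?B}"
  have B: "openin R' ?B"
    using charts by (auto simp: complex_chart_def)
  note hF = in_coords_holomorphic[OF assms(5) z assms(9) B Int_lower1]
  note hG = in_coords_holomorphic[OF assms(5) z w\<^sub>2 B Int_lower2]
  \<comment> \<open>An open neighbourhood of the point on which both target charts are available and
    the derivative does not vanish.\<close>
  let ?W = "?U \<inter> deriv ?F -` (- {0})"
  have W: "open ?W"
    using hF(1,2)
    by (intro continuous_open_preimage holomorphic_on_imp_continuous_on holomorphic_deriv) auto
  have \<zeta>U: "?\<zeta> \<in> ?U" and \<zeta>W: "?\<zeta> \<in> ?W"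
    using assms(8,10,14,15) by auto
  have V: "open (snd w ` fst w)"
    using charts by (simp add: complex_chart_def)
  note \<rho>' = conformal_metric_log_differentiable[OF assms(3) z]
  note \<sigma>' = conformal_metric_log_differentiable[OF assms(4,9)]
  have "invariant_schwarzian \<rho> \<sigma> f z w ?\<zeta> =
      (\<partial> ?T ?\<zeta> - (?T ?\<zeta>)\<^sup>2 / 2 - schwarzian_metric \<rho> z ?\<zeta>) / (of_real (\<rho> z ?\<zeta>))\<^sup>2"
    unfolding invariant_schwarzian_def schwarzian_metric_def
  proof (rule invariant_schwarzian_plane[OF W _ \<zeta>W])
    show "?F holomorphic_on ?W"
      using hF(2) by (rule holomorphic_on_subset) auto
    show sub: "?F ` ?W \<subseteq> snd w ` fst w"
      using hF(3) by blast
    show "\<partial> (clog_metric (\<sigma> w)) differentiable (at (?F ?\<zeta>))"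
      using sub \<zeta>W by (intro \<sigma>') blast
    show "\<partial> (clog_metric (\<rho> z)) differentiable (at ?\<zeta>)"
      using assms(8) by (intro \<rho>') blast
  qed (use V in \<open>auto intro: \<rho>' \<sigma>'\<close>)
  \<comment> \<open>Passage from \<open>w\<close> to the projective coordinate
    \<open>w\<^sub>2\<close>. Equality of the two functions T at a single point would not give equal
    derivatives; they agree on all of \<open>?W\<close>.\<close>
  also have "\<partial> ?T ?\<zeta> - (?T ?\<zeta>)\<^sup>2 / 2 = \<partial> ?T\<^sub>2 ?\<zeta> - (?T\<^sub>2 ?\<zeta>)\<^sup>2 / 2"
  proof -
    have eq: "?T\<^sub>2 y = ?T y" if yW: "y \<in> ?W" for y
    proof -
      obtain q where q: "q \<in> fst z" "f q \<in> fst w" "f q \<in> fst w\<^sub>2" and y: "y = snd z q"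
        and nz: "deriv ?F (snd z q) \<noteq> 0"
        using yW by blast
      show ?thesis
        unfolding y by (rule change_target_coord(2)[OF assms(4,5) z assms(9) w\<^sub>2 assms(13) q nz])
    qed
    have "?F ?\<zeta> \<in> snd w ` fst w"
      using hF(3) \<zeta>U by blast
    note has_wirtinger_pre_schwarzian[OF hF(2,1) \<zeta>U assms(15) \<sigma>'(2)[OF this]]
    note T = has_wirtinger_wirtinger[of ?T ?\<zeta>, OF this[unfolded has_wirtinger_def, THEN conjunct1]]
    have "has_wirtinger ?T\<^sub>2 (\<partial> ?T ?\<zeta>) ?\<zeta>"
      by (rule has_wirtinger_transform[OF T W \<zeta>W]) (simp add: eq)
    then show ?thesis
      using eq[OF \<zeta>W] has_wirtinger_imp_wirtinger by metis
  qed
  also have "\<dots> = schwarzian_map f z w\<^sub>2 ?\<zeta> + pullback_qd f (schwarzian_metric \<sigma>) z w\<^sub>2 ?\<zeta>"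
    unfolding schwarzian_map_def pullback_qd_def schwarzian_metric_def
  proof (rule wirtinger_pre_schwarzian[OF hG(2,1) \<zeta>U])
    show "deriv ?G ?\<zeta> \<noteq> 0"
      by (rule change_target_coord(1)[OF assms(4,5) z assms(9) w\<^sub>2 assms(13,8,10,14,15)])
    show "\<partial> (clog_metric (\<sigma> w\<^sub>2)) differentiable (at (?G ?\<zeta>))"
      using hG(3) \<zeta>U by (intro conformal_metric_log_differentiable(2)[OF assms(4) w\<^sub>2]) blast
  qed
  \<comment> \<open>Only the Schwarzian of \<open>f\<close> is moved to \<open>w\<^sub>1\<close>;
    the pull-back already stands in \<open>w\<^sub>2\<close>.\<close>
  also have "schwarzian_map f z w\<^sub>2 ?\<zeta> = schwarzian_map f z w\<^sub>1 ?\<zeta>"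
  proof (rule schwarzian_map_projective_coord[OF assms(2,4,5) z assms(11,13,8,12,14)])
    show "deriv (in_coords z w\<^sub>1 f) ?\<zeta> \<noteq> 0"
      by (rule change_target_coord(1)[OF assms(4,5) z assms(9)
            projective_coord_imp_local_coord[OF assms(2,11)] assms(11,8,10,12,15)])
  qed
  finally show ?thesis .
qed

end
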